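(* Let $r\in[1,\infty)$ and $\mathcal H\subseteq L^1[\mathcal F_c(\mathbb R^p)]$. Then $D_r$ based on $\mathcal J=\mathcal F_c(\mathbb R^p)$ and $\mathcal H$ satisfies property P2 for functional symmetry; that is, for every $\mathcal X\in\mathcal H$ which is functionally symmetric with respect to some $U\in\mathcal F_c(\mathbb R^p)$, $$D_r(U;\mathcal X)=\sup_{B\in\mathcal F_c(\mathbb R^p)}D_r(B;\mathcal X).$$
   Context: Fix an integer $p\ge1$; $\mathbb S^{p-1}=\{u\in\mathbb R^p:\|u\|=1\}$ with $\|\cdot\|$ the Euclidean norm. For $A:\mathbb R^p\to[0,1]$ the $\alpha$-levels are $A_\alpha=\{x:A(x)\ge\alpha\}$ for $\alpha\in(0,1]$, and $A_0$ is the closure of $\{x:A(x)>0\}$. $\mathcal F_c(\mathbb R^p)$ is the set of all $A:\mathbb R^p\to[0,1]$ such that $A_\alpha$ is non-empty, compact and convex for each $\alpha\in[0,1]$. $\mathcal K_c(\mathbb R^p)$ is the class of non-empty compact convex subsets of $\mathbb R^p$; $\|K\|=\max_{x\in K}\|x\|$ for $K\in\mathcal K_c(\mathbb R^p)$. The support function of $A$ is $s_A(u,\alpha)=\sup_{v\in A_\alpha}\langle u,v\rangle$, $(u,\alpha)\in\mathbb S^{p-1}\times[0,1]$. With $\mathcal V_p$ the normalized Haar (uniform probability) measure on $\mathbb S^{p-1}$ and $\nu$ the Lebesgue measure on $[0,1]$, $\rho_r(A,B)=\left(\int_{[0,1]}\int_{\mathbb S^{p-1}}|s_A(u,\alpha)-s_B(u,\alpha)|^r\,d\mathcal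 V_p(u)\,d\nu(\alpha)\right)^{1/r}$. Given a probability space $(\Omega,\mathcal A,\mathbb P)$, a map $\mathcal X:\Omega\to\mathcal F_c(\mathbb R^p)$ is a fuzzy random variable if for every $\alpha\in[0,1]$ the map $\omega\mapsto\mathcal X_\alpha(\omega)=\mathcal X(\omega)_\alpha\in\mathcal K_c(\mathbb R^p)$ is Borel measurable with respect to the Hausdorff metric. $L^1[\mathcal F_c(\mathbb R^p)]$ is the class of fuzzy random variables with $\mathrm E[\|\mathcal X_0\|]<\infty$. The support function of $\mathcal X$ is $s_{\mathcal X}(u,\alpha,\omega)=s_{\mathcal X(\omega)}(u,\alpha)$. The $r$-natural depth is $D_r(A;\mathcal X)=(1+\mathrm E[\rho_r(A,\mathcal X)])^{-1}$. $\mathcal X$ is functionally symmetric with respect to $A\in\mathcal F_c(\mathbb R^p)$ if $s_{\mathcal X}-s_A$ is identically distributed as $s_A-s_{\mathcal X}$, as random elements of the function space $L^r(\mathbb S^{p-1}\times[0,1],\mathcal V_p\otimes\nu)$ (this notion does not depend on the choice of $r\in[1,\infty)$). *)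

theory Defs
  imports "HOL-Probability.Probability"
begin

section \<open>Fuzzy sets and their levels\<close>

type_synonym 'p fuzzy = "real ^ 'p \<Rightarrow> real"

definition level :: "'p::finite fuzzy \<Rightarrow> real \<Rightarrow> (real ^ 'p) set" where
  "level A \<alpha> = (if \<alpha> = 0 then closure {x. A x > 0} else {x. A x \<ge> \<alpha>})"

definition Kc :: "(real ^ 'p::finite) set set" where
  "Kc = {K. K \<noteq> {} \<and> compact K \<and> convex K}"

definition Fc :: "'p::finite fuzzy set" where
  "Fc = {A. (\<forall>x. A x \<in> {0..1}) \<and> (\<forall>\<alpha>\<in>{0..1}. level A \<alpha> \<in> Kc)}"

definition Kc_norm :: "(real ^ 'p::finite) set \<Rightarrow> real" where
  "Kc_norm K = (SUP x\<in>K. norm x)"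

definition support_fun :: "'p::finite fuzzy \<Rightarrow> (real ^ 'p) \<times> real \<Rightarrow> real" where
  "support_fun A = (\<lambda>(u, \<alpha>). SUP v\<in>level A \<alpha>. u \<bullet> v)"


section \<open>Borel sigma-algebra of a metric on a carrier set\<close>

definition metric_borel :: "'a set \<Rightarrow> ('a \<Rightarrow> 'a \<Rightarrow> real) \<Rightarrow> 'a measure" where
  "metric_borel S d = sigma S {U. openin (Metric_space.mtopology S d) U}"

text \<open>The value 0 outside \<^const>\<open>Kc\<close> only serves to make the function symmetric and
  non-negative everywhere, as the locale \<^locale>\<open>Metric_space\<close> requires.\<close>

definition hausdorff_dist :: "(real ^ 'p::finite) set \<Rightarrow> (real ^ 'p) set \<Rightarrow> real" where
  "hausdorff_dist K L =
     (if K \<in> Kc \<and> L \<in> Kc then max (SUP x\<in>K. infdist x L) (SUP y\<in>L. infdist y K) else 0)"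

lemma bdd_above_infdist:
  fixes K L :: "(real ^ 'p::finite) set"
  assumes "K \<in> Kc"
  shows "bdd_above ((\<lambda>x. infdist x L) ` K)"
proof -
  have "compact ((\<lambda>x. infdist x L) ` K)"
    using assms by (intro compact_continuous_image continuous_intros) (auto simp: Kc_def)
  then show ?thesis
    by (simp add: bounded_imp_bdd_above compact_imp_bounded)
qed

lemma infdist_le_hausdorff_dist:
  assumes "K \<in> Kc" "L \<in> Kc" "x \<in> K"
  shows "infdist x L \<le> hausdorff_dist K L"
proof -
  have "infdist x L \<le> (SUP x\<in>K. infdist x L)"
    by (rule cSUP_upper) (use assms bdd_above_infdist in auto)
  then show ?thesis
    using assms by (auto simp: hausdorff_dist_def)
qed

lemma hausdorff_dist_commute: "hausdorff_dist K L = hausdorff_dist L K"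
  by (auto simp: hausdorff_dist_def max.commute)

lemma hausdorff_dist_leI:
  assumes "K \<in> Kc" "L \<in> Kc"
    and "\<And>x. x \<in> K \<Longrightarrow> infdist x L \<le> c" "\<And>x. x \<in> L \<Longrightarrow> infdist x K \<le> c"
  shows "hausdorff_dist K L \<le> c"
  using assms by (auto simp: hausdorff_dist_def Kc_def intro!: cSUP_least)

lemma infdist_hausdorff_triangle:
  assumes "K \<in> Kc" "L \<in> Kc" "P \<in> Kc" "x \<in> K"
  shows "infdist x P \<le> hausdorff_dist K L + hausdorff_dist L P"
proof -
  obtain y where y: "y \<in> L" "infdist x L = dist x y"
    using infdist_attains_inf[of L x] assms by (auto simp: Kc_def compact_imp_closed)
  have "infdist x P \<le> infdist y P + dist x y"
    by (rule infdist_triangle)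
  also have "infdist y P \<le> hausdorff_dist L P"
    by (rule infdist_le_hausdorff_dist) (use assms y in auto)
  also have "dist x y \<le> hausdorff_dist K L"
    using infdist_le_hausdorff_dist[of K L x] assms y by auto
  finally show ?thesis by simp
qed

lemma Metric_space_Kc: "Metric_space Kc hausdorff_dist"
proof
  fix K L :: "(real ^ 'p) set"
  show "0 \<le> hausdorff_dist K L"
  proof (cases "K \<in> Kc \<and> L \<in> Kc")
    case True
    then obtain x where "x \<in> K" by (auto simp: Kc_def)
    with True show ?thesis
      using infdist_le_hausdorff_dist[of K L x] infdist_nonneg[of x L] by auto
  qed (auto simp: hausdorff_dist_def)
  show "hausdorff_dist K L = hausdorff_dist L K"
    by (rule hausdorff_dist_commute)
next
  fix K L :: "(real ^ 'p) set"
  assume KL: "K \<in> Kc" "L \<in> Kc"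
  have sub: "A \<subseteq> B" if "A \<in> Kc" "B \<in> Kc" "hausdorff_dist A B = 0" for A B :: "(real ^ 'p) set"
  proof
    fix x assume "x \<in> A"
    then have "infdist x B = 0"
      using infdist_le_hausdorff_dist[of A B x] infdist_nonneg[of x B] that by auto
    then show "x \<in> B"
      using that in_closed_iff_infdist_zero[of B x] by (auto simp: Kc_def compact_imp_closed)
  qed
  show "hausdorff_dist K L = 0 \<longleftrightarrow> K = L"
  proof
    assume "hausdorff_dist K L = 0"
    then show "K = L"
      using sub[of K L] sub[of L K] KL by (auto simp: hausdorff_dist_commute[of L K])
  next
    assume "K = L"
    with KL show "hausdorff_dist K L = 0"
      by (auto simp: hausdorff_dist_def Kc_def)
  qed
next
  fix K L P :: "(real ^ 'p) set"
  assume *: "K \<in> Kc" "L \<in> Kc" "P \<in> Kc"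
  show "hausdorff_dist K P \<le> hausdorff_dist K L + hausdorff_dist L P"
  proof (rule hausdorff_dist_leI)
    show "infdist x P \<le> hausdorff_dist K L + hausdorff_dist L P" if "x \<in> K" for x
      by (rule infdist_hausdorff_triangle) (use * that in auto)
    show "infdist x K \<le> hausdorff_dist K L + hausdorff_dist L P" if "x \<in> P" for x
      using infdist_hausdorff_triangle[OF *(3,2,1) that]
        hausdorff_dist_commute[of P L] hausdorff_dist_commute[of L K] by linarith
  qed (use * in auto)
qed


section \<open>Fuzzy random variables\<close>

definition fuzzy_random_variable :: "'w measure \<Rightarrow> ('w \<Rightarrow> 'p::finite fuzzy) \<Rightarrow> bool" where
  "fuzzy_random_variable M X \<longleftrightarrow>
     X \<in> space M \<rightarrow> Fc \<and>
     (\<forall>\<alpha>\<in>{0..1}. (\<lambda>\<omega>. level (X \<omega>) \<alpha>) \<in> measurable M (metric_borel Kc hausdorff_dist))"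

text \<open>Apart from finiteness of the expectation, \<^const>\<open>integrable\<close> asks for measurability, which
  is no restriction: \<^const>\<open>Kc_norm\<close> is 1-Lipschitz for the Hausdorff metric.\<close>

definition L1_Fc :: "'w measure \<Rightarrow> ('w \<Rightarrow> 'p::finite fuzzy) set" where
  "L1_Fc M = {X. fuzzy_random_variable M X \<and> integrable M (\<lambda>\<omega>. Kc_norm (level (X \<omega>) 0))}"


section \<open>Normalized Haar measure on the sphere\<close>

definition rotation_invariant_prob :: "(real ^ 'p::finite) measure \<Rightarrow> bool" where
  "rotation_invariant_prob V \<longleftrightarrow>
     prob_space V \<and> sets V = sets (restrict_space borel (sphere 0 1)) \<and>
     (\<forall>T. orthogonal_transformation T \<longrightarrow> distr V V T = V)"

definition sphere_haar :: "(real ^ 'p::finite) measure" where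
  "sphere_haar = (THE V. rotation_invariant_prob V)"

lemma orthogonal_transformation_measurable:
  fixes T :: "real ^ 'p::finite \<Rightarrow> real ^ 'p"
  assumes "orthogonal_transformation T"
  shows "T \<in> borel_measurable borel"
  using linear_conv_bounded_linear[THEN iffD1, OF orthogonal_transformation_linear[OF assms]]
  by (intro borel_measurable_continuous_onI linear_continuous_on)

lemma orthogonal_transformation_measurable_sphere:
  fixes T :: "real ^ 'p::finite \<Rightarrow> real ^ 'p"
  assumes T: "orthogonal_transformation T"
  shows "T \<in> measurable (restrict_space borel (sphere 0 1)) (restrict_space borel (sphere 0 1))"
  using orthogonal_transformation_measurable[OF T] orthogonal_transformation_norm[OF T]
  by (intro measurable_restrict_space2 measurable_restrict_space1) (auto simp: space_restrict_space)

lemma emeasure_lborel_orthogonal_open_le: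
  fixes T :: "real ^ 'p::finite \<Rightarrow> real ^ 'p"
  assumes T: "orthogonal_transformation T" and U: "open U"
  shows "emeasure lborel U \<le> emeasure lborel (T -` U)"
proof -
  obtain S where S: "\<And>x. S (T x) = x" "\<And>x. T (S x) = x"
    using orthogonal_transformation_bij[OF T] by (metis bij_inv_eq_iff)
  have dT: "dist (T a) (T b) = dist a b" for a b
    using T orthogonal_transformation_isometry by blast
  have ball: "T -` ball x r = ball (S x) r" for x r
    using dT[of "S x"] by (auto simp: S)
  have T_meas: "T -` A \<in> sets borel" if "A \<in> sets borel" for A
    using measurable_sets[OF orthogonal_transformation_measurable[OF T] that] by simp
  define K where "K = {i :: (real ^ 'p) \<times> real. ball (fst i) (snd i) \<subseteq> U}"
  have cov: "\<exists>i. i \<in> K \<and> x \<in> ball (fst i) (snd i) \<and> snd i < d" if x: "x \<in> U" and d: "0 < d" for x d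
  proof -
    obtain e where e: "e > 0" "ball x e \<subseteq> U" using x U openE by blast
    have "ball x (min e (d / 2)) \<subseteq> U" using e by auto
    then show ?thesis
      using e d by (intro exI[of _ "(x, min e (d / 2))"]) (auto simp: K_def)
  qed
  obtain C where C: "countable C" "C \<subseteq> K"
      and disj: "pairwise (\<lambda>i j. disjnt (ball (fst i) (snd i)) (ball (fst j) (snd j))) C"
      and neg: "negligible (U - (\<Union>i\<in>C. ball (fst i) (snd i)))"
    by (rule Vitali_covering_theorem_balls[of U K fst snd, OF cov])
  let ?W = "\<Union>i\<in>C. ball (fst i) (snd i)"
  have W: "open ?W" "?W \<subseteq> U" using C by (auto simp: K_def)
  have "U - ?W \<in> null_sets lborel"
    using neg U W by (simp add: negligible_iff_null_sets null_sets_completion_iff borel_open sets.Diff)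
  then have "emeasure lborel U = emeasure lborel (U - (U - ?W))"
    using U by (subst emeasure_Diff_null_set) (auto simp: borel_open)
  also have "U - (U - ?W) = ?W" using W by auto
  also have "emeasure lborel ?W = (\<integral>\<^sup>+i. emeasure lborel (ball (fst i) (snd i)) \<partial>count_space C)"
    using C disj by (intro emeasure_UN_countable)
      (auto simp: disjoint_family_on_def pairwise_def disjnt_def)
  also have "\<dots> = (\<integral>\<^sup>+i. emeasure lborel (T -` ball (fst i) (snd i)) \<partial>count_space C)"
    unfolding ball
  proof (rule nn_integral_cong)
    fix i
    show "emeasure lborel (ball (fst i) (snd i)) = emeasure lborel (ball (S (fst i)) (snd i))"
      by (cases "snd i \<ge> 0") (simp_all add: emeasure_ball ball_empty)
  qed
  also have "\<dots> = emeasure lborel (\<Union>i\<in>C. T -` ball (fst i) (snd i))"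
  proof (rule emeasure_UN_countable[symmetric])
    have "disjoint_family_on (\<lambda>i. ball (fst i) (snd i)) C"
      using disj by (simp add: disjoint_family_on_def pairwise_def disjnt_def)
    then show "disjoint_family_on (\<lambda>i. T -` ball (fst i) (snd i)) C"
      unfolding disjoint_family_on_def by blast
  qed (use C T_meas in auto)
  also have "\<dots> \<le> emeasure lborel (T -` U)"
    using W U T_meas by (intro emeasure_mono) (auto simp: borel_open)
  finally show ?thesis .
qed

lemma emeasure_lborel_orthogonal:
  fixes T :: "real ^ 'p::finite \<Rightarrow> real ^ 'p"
  assumes T: "orthogonal_transformation T" and A: "A \<in> sets borel"
  shows "emeasure lborel (T -` A) = emeasure lborel A"
proof -
  note T_meas = orthogonal_transformation_measurable[OF T]
  obtain S where S: "orthogonal_transformation S" "\<And>x. S (T x) = x" "\<And>x. T (S x) = x"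
    using orthogonal_transformation_inv[OF T] orthogonal_transformation_bij[OF T]
    by (metis bij_inv_eq_iff)
  have "continuous_on UNIV T"
    using linear_conv_bounded_linear[THEN iffD1, OF orthogonal_transformation_linear[OF T]]
    by (rule linear_continuous_on)
  then have open_eq: "emeasure lborel (T -` U) = emeasure lborel U" if "open U" for U
  proof -
    have "open (T -` U)" using that \<open>continuous_on UNIV T\<close> by (rule open_vimage)
    from emeasure_lborel_orthogonal_open_le[OF S(1) this]
    have "emeasure lborel (T -` U) \<le> emeasure lborel (S -` T -` U)" .
    also have "S -` T -` U = U" by (auto simp: S)
    finally show ?thesis
      using emeasure_lborel_orthogonal_open_le[OF T that] by (rule antisym)
  qed
  have "lborel = distr lborel borel T"
  proof (rule lborel_eqI)
    fix l u :: "real ^ 'p" assume lu: "\<And>b. b \<in> Basis \<Longrightarrow> l \<bullet> b \<le> u \<bullet> b"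
    have "emeasure (distr lborel borel T) (box l u) = emeasure lborel (T -` box l u)"
      using T_meas by (simp add: emeasure_distr)
    also have "\<dots> = emeasure lborel (box l u)"
      by (rule open_eq[OF open_box])
    also have "\<dots> = (\<Prod>b\<in>Basis. (u - l) \<bullet> b)"
      by (rule emeasure_lborel_box[OF lu])
    finally show "emeasure (distr lborel borel T) (box l u) = (\<Prod>b\<in>Basis. (u - l) \<bullet> b)" .
  qed simp
  then have "emeasure lborel A = emeasure (distr lborel borel T) A" by simp
  also have "\<dots> = emeasure lborel (T -` A)"
    using T_meas A by (simp add: emeasure_distr)
  finally show ?thesis by simp
qed

text \<open>Existence: push the uniform distribution on the punctured unit ball forward along
  \<open>x \<mapsto> x / \<parallel>x\<parallel>\<close>.\<close>

lemma ex_rotation_invariant_prob: "\<exists>V :: (real ^ 'p::finite) measure. rotation_invariant_prob V"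
proof -
  obtain b :: "real ^ 'p" where b: "norm b = 1"
    using vector_choose_size[of 1] by auto
  define g where "g x = (if x = 0 then b else sgn x)" for x :: "real ^ 'p"
  define B where "B = ball (0 :: real ^ 'p) 1 - {0}"
  let ?S = "restrict_space borel (sphere (0 :: real ^ 'p) 1)"
  let ?U = "uniform_measure lborel B"
  have [measurable]: "B \<in> sets borel" by (simp add: B_def)
  have "bounded B" by (auto simp: B_def intro: bounded_diff)
  have "g \<in> borel_measurable borel" unfolding g_def sgn_div_norm by measurable
  then have g: "g \<in> measurable borel ?S"
    using b by (intro measurable_restrict_space2) (auto simp: g_def norm_sgn)
  have "emeasure lborel B = emeasure lborel (ball (0 :: real ^ 'p) 1)"
    unfolding B_def by (subst emeasure_Diff_null_set) auto
  then have eB: "emeasure lborel B \<noteq> 0" "emeasure lborel B \<noteq> \<infinity>"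
    using emeasure_bounded_finite[OF \<open>bounded B\<close>] 
      less_imp_neq[OF unit_ball_vol_pos[of "real CARD('p)"]]
    by (auto simp: emeasure_ball)
  define V where "V = distr ?U ?S g"
  have "prob_space ?U" by (rule prob_space_uniform_measure[OF eB])
  then have "prob_space V" unfolding V_def using g by (intro prob_space.prob_space_distr) simp_all
  moreover have setsV: "sets V = sets ?S" by (simp add: V_def)
  moreover have "distr V V T = V" if T: "orthogonal_transformation T" for T
  proof (rule measure_eqI)
    fix A assume "A \<in> sets (distr V V T)"
    then have A: "A \<in> sets ?S" by (simp add: V_def)
    have gA: "g -` A \<in> sets borel" using measurable_sets[OF g A] by simp
    have TS: "T \<in> measurable ?S ?S" by (rule orthogonal_transformation_measurable_sphere[OF T])
    have TA: "T -` A \<inter> sphere 0 1 \<in> sets ?S"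
      using measurable_sets[OF TS A] by (simp add: space_restrict_space)
    have gTA: "g -` (T -` A \<inter> sphere 0 1) \<in> sets borel" using measurable_sets[OF g TA] by simp
    have Tg: "T (g x) = g (T x)" if "x \<noteq> 0" for x
      using that T orthogonal_transformation_norm[OF T, of x] orthogonal_transformation_linear[OF T]
      by (auto simp: g_def sgn_div_norm linear_cmul)
    have T0: "T x = 0 \<longleftrightarrow> x = 0" for x
      using orthogonal_transformation_norm[OF T, of x] by (metis norm_eq_zero)
    have gs: "norm (g x) = 1" for x using b by (simp add: g_def norm_sgn)
    have eq: "B \<inter> g -` (T -` A \<inter> sphere 0 1) = T -` (B \<inter> g -` A)"
      using Tg T0 orthogonal_transformation_norm[OF T] gs by (auto simp: B_def)
    have "emeasure (distr V V T) A = emeasure V (T -` A \<inter> sphere 0 1)"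
      using TS A by (subst emeasure_distr)
        (auto simp: V_def space_restrict_space cong: measurable_cong_sets)
    also have "\<dots> = emeasure ?U (g -` (T -` A \<inter> sphere 0 1))"
      unfolding V_def using g TA by (subst emeasure_distr) auto
    also have "\<dots> = emeasure lborel (T -` (B \<inter> g -` A)) / emeasure lborel B"
      unfolding eq[symmetric] using gTA by (intro emeasure_uniform_measure) simp_all
    also have "\<dots> = emeasure lborel (B \<inter> g -` A) / emeasure lborel B"
      using T gA by (subst emeasure_lborel_orthogonal) auto
    also have "\<dots> = emeasure V A"
      unfolding V_def using g A gA by (subst emeasure_distr) auto
    finally show "emeasure (distr V V T) A = emeasure V A" .
  qed simp
  ultimately show ?thesis
    unfolding rotation_invariant_prob_def by blast
qed

text \<open>Uniqueness: by transitivity of the orthogonal group, the mass of a ball of radius \<open>e\<close>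
  centred on the sphere does not depend on the centre. Averaging a Lipschitz function over such
  balls and applying Fubini shows that two invariant probabilities have the same integrals.\<close>

lemma rotation_invariant_prob_ball:
  fixes M :: "(real ^ 'p::finite) measure"
  assumes M: "rotation_invariant_prob M" and "x \<in> sphere 0 1" "y \<in> sphere 0 1"
  shows "measure M (ball x e \<inter> sphere 0 1) = measure M (ball y e \<inter> sphere 0 1)"
proof -
  obtain T where T: "orthogonal_transformation T" "T x = y"
    using orthogonal_transformation_exists_1[of x y] assms by auto
  have sets: "sets M = sets (restrict_space borel (sphere 0 1))" and inv: "distr M M T = M"
    using M T by (auto simp: rotation_invariant_prob_def)
  have space: "space M = sphere 0 1"
    using sets_eq_imp_space_eq[OF sets] by (simp add: space_restrict_space)
  have TM: "T \<in> measurable M M"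
    using orthogonal_transformation_measurable_sphere[OF T(1)] sets
    by (simp cong: measurable_cong_sets)
  have dT: "dist (T a) (T b) = dist a b" for a b
    using T(1) orthogonal_transformation_isometry by blast
  have "measure M (ball y e \<inter> sphere 0 1) = measure (distr M M T) (ball y e \<inter> sphere 0 1)"
    by (simp add: inv)
  also have "\<dots> = measure M (T -` (ball y e \<inter> sphere 0 1) \<inter> space M)"
    using TM by (intro measure_distr) (auto simp: sets sets_restrict_space)
  also have "T -` (ball y e \<inter> sphere 0 1) \<inter> space M = ball x e \<inter> sphere 0 1"
    using dT[of x] T orthogonal_transformation_norm[OF T(1)] by (auto simp: space)
  finally show ?thesis by simp
qed

lemma rotation_invariant_prob_ball_pos:
  fixes M :: "(real ^ 'p::finite) measure"
  assumes M: "rotation_invariant_prob M" and x: "x \<in> sphere 0 1" and e: "e > 0"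
  shows "measure M (ball x e \<inter> sphere 0 1) > 0"
proof (rule ccontr)
  interpret prob_space M using M by (simp add: rotation_invariant_prob_def)
  have sets: "sets M = sets (restrict_space borel (sphere 0 1))"
    using M by (simp add: rotation_invariant_prob_def)
  have space: "space M = sphere 0 1"
    using sets_eq_imp_space_eq[OF sets] by (simp add: space_restrict_space)
  assume "\<not> ?thesis"
  then have 0: "measure M (ball x e \<inter> sphere 0 1) = 0"
    using measure_nonneg[of M "ball x e \<inter> sphere 0 1"] by linarith
  have "sphere (0 :: real ^ 'p) 1 \<subseteq> (\<Union>y\<in>sphere 0 1. ball y e)"
    using e by force
  then obtain C where C: "C \<subseteq> sphere 0 1" "finite C" "sphere (0 :: real ^ 'p) 1 \<subseteq> (\<Union>y\<in>C. ball y e)"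
    using compactE_image[OF compact_sphere, of "sphere 0 1" "\<lambda>y. ball y e"] by (metis open_ball)
  have "measure M (sphere 0 1) = measure M (\<Union>y\<in>C. ball y e \<inter> sphere 0 1)"
    using C by (intro arg_cong[where f = "measure M"]) auto
  also have "\<dots> \<le> (\<Sum>y\<in>C. measure M (ball y e \<inter> sphere 0 1))"
    using C by (intro finite_measure_subadditive_finite) (auto simp: sets sets_restrict_space)
  also have "\<dots> = 0"
    using C rotation_invariant_prob_ball[OF M _ x, of _ e] 0 by (intro sum.neutral) auto
  finally show False using prob_space by (simp add: space)
qed

lemma rotation_invariant_prob_integral:
  fixes M N :: "(real ^ 'p::finite) measure"
  assumes M: "rotation_invariant_prob M" and N: "rotation_invariant_prob N"
    and f: "\<And>x. \<bar>f x\<bar> \<le> 1" and lip: "\<And>x y. \<bar>f x - f y\<bar> \<le> L * dist x y"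
    and fb: "f \<in> borel_measurable borel"
  shows "(\<integral>x. f x \<partial>M) = (\<integral>x. f x \<partial>N)"
proof -
  interpret M: prob_space M using M by (simp add: rotation_invariant_prob_def)
  interpret N: prob_space N using N by (simp add: rotation_invariant_prob_def)
  interpret P: pair_prob_space M N ..
  have sets: "sets M = sets (restrict_space borel (sphere 0 1))"
      "sets N = sets (restrict_space borel (sphere 0 1))"
    using M N by (simp_all add: rotation_invariant_prob_def)
  have space: "space M = sphere 0 1" "space N = sphere 0 1"
    using sets_eq_imp_space_eq[OF sets(1)] sets_eq_imp_space_eq[OF sets(2)]
    by (simp_all add: space_restrict_space)
  have idM: "(\<lambda>x. x) \<in> borel_measurable M" and idN: "(\<lambda>x. x) \<in> borel_measurable N"
    using measurable_restrict_space1[OF measurable_ident[unfolded id_def], of borel "sphere (0 :: real ^ 'p) 1"]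
    by (simp_all add: sets cong: measurable_cong_sets)
  have [measurable]: "f \<in> borel_measurable M" "f \<in> borel_measurable N"
    using measurable_compose[OF idM fb] measurable_compose[OF idN fb] by auto
  obtain b :: "real ^ 'p" where b: "norm b = 1"
    using vector_choose_size[of 1] by auto
  have L: "L \<ge> 0" using lip[of b 0] b by (simp add: dist_norm)
  have main: "\<bar>(\<integral>x. f x \<partial>M) - (\<integral>x. f x \<partial>N)\<bar> \<le> L * e" if e: "e > 0" for e
  proof -
    define m n where "m = measure M (ball b e \<inter> sphere 0 1)" and "n = measure N (ball b e \<inter> sphere 0 1)"
    have n: "n > 0" using rotation_invariant_prob_ball_pos[OF N _ e, of b] b by (simp add: n_def)
    define k where "k x y = (indicator {z :: (real ^ 'p) \<times> (real ^ 'p). dist (fst z) (snd z) < e} (x, y) :: real)"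
      for x y :: "real ^ 'p"
    have fst': "(\<lambda>z. fst z) \<in> borel_measurable (M \<Otimes>\<^sub>M N)" and snd': "(\<lambda>z. snd z) \<in> borel_measurable (M \<Otimes>\<^sub>M N)"
      using measurable_compose[OF measurable_fst idM] measurable_compose[OF measurable_snd idN] by auto
    have "(\<lambda>z. dist (fst z) (snd z)) \<in> borel_measurable (M \<Otimes>\<^sub>M N)"
      using fst' snd' by (rule borel_measurable_dist)
    then have "{z \<in> Sigma_Algebra.space (M \<Otimes>\<^sub>M N). dist (fst z) (snd z) < e} \<in> sets (M \<Otimes>\<^sub>M N)"
      by measurable
    then have "(indicator {z \<in> Sigma_Algebra.space (M \<Otimes>\<^sub>M N). dist (fst z) (snd z) < e} :: _ \<Rightarrow> real)
        \<in> borel_measurable (M \<Otimes>\<^sub>M N)" by simp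
    then have k[measurable]: "(\<lambda>(x, y). k x y) \<in> borel_measurable (M \<Otimes>\<^sub>M N)"
      by (rule measurable_cong[THEN iffD1, rotated]) (auto simp: k_def indicator_def)
    have kb: "\<bar>k x y\<bar> \<le> 1" "k x y \<ge> 0" for x y by (auto simp: k_def indicator_def)
    have kM: "(\<integral>x. k x y \<partial>M) = m" if "y \<in> sphere 0 1" for y
    proof -
      have "(\<integral>x. k x y \<partial>M) = (\<integral>x. indicator (ball y e \<inter> sphere 0 1) x \<partial>M)"
        by (intro Bochner_Integration.integral_cong) (auto simp: k_def indicator_def space dist_commute)
      also have "\<dots> = measure M (ball y e \<inter> sphere 0 1)"
        by (simp add: sets sets_restrict_space space Int_absorb2 Int_assoc)
      also have "\<dots> = m"
        unfolding m_def using that b by (intro rotation_invariant_prob_ball[OF M]) auto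
      finally show ?thesis .
    qed
    have kN: "(\<integral>y. k x y \<partial>N) = n" if "x \<in> sphere 0 1" for x
    proof -
      have "(\<integral>y. k x y \<partial>N) = (\<integral>y. indicator (ball x e \<inter> sphere 0 1) y \<partial>N)"
        by (intro Bochner_Integration.integral_cong) (auto simp: k_def indicator_def space)
      also have "\<dots> = measure N (ball x e \<inter> sphere 0 1)"
        by (simp add: sets sets_restrict_space space Int_absorb2 Int_assoc)
      also have "\<dots> = n"
        unfolding n_def using that b by (intro rotation_invariant_prob_ball[OF N]) auto
      finally show ?thesis .
    qed
    have kf: "\<bar>k x y * f z\<bar> \<le> 1" for x y z
      using mult_mono[OF kb(1)[of x y] f[of z]] by (simp add: abs_mult)
    have I: "integrable (M \<Otimes>\<^sub>M N) (\<lambda>(x, y). k x y)"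
        "integrable (M \<Otimes>\<^sub>M N) (\<lambda>(x, y). k x y * f x)"
        "integrable (M \<Otimes>\<^sub>M N) (\<lambda>(x, y). k x y * f y)"
      using kb kf by (auto intro!: P.integrable_const_bound[where B = 1] simp: split_beta' k[unfolded split_beta'])
    have "m = (\<integral>y. (\<integral>x. k x y \<partial>M) \<partial>N)"
      using Bochner_Integration.integral_cong[OF refl, of N "\<lambda>y. \<integral>x. k x y \<partial>M" "\<lambda>_. m"]
      by (simp add: kM space(2) N.prob_space[unfolded space(2)])
    also have "\<dots> = (\<integral>x. (\<integral>y. k x y \<partial>N) \<partial>M)"
      by (rule P.Fubini_integral[OF I(1)])
    also have "\<dots> = n"
      using Bochner_Integration.integral_cong[OF refl, of M "\<lambda>x. \<integral>y. k x y \<partial>N" "\<lambda>_. n"]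
      by (simp add: kN space(1) M.prob_space[unfolded space(1)])
    finally have mn: "m = n" .
    have 1: "(\<integral>z. (\<lambda>(x, y). k x y * f x) z \<partial>(M \<Otimes>\<^sub>M N)) = n * (\<integral>x. f x \<partial>M)"
    proof -
      have "(\<integral>z. (\<lambda>(x, y). k x y * f x) z \<partial>(M \<Otimes>\<^sub>M N)) = (\<integral>x. (\<integral>y. k x y * f x \<partial>N) \<partial>M)"
        using P.integral_fst'[OF I(2)] by simp
      also have "\<dots> = (\<integral>x. n * f x \<partial>M)"
        by (intro Bochner_Integration.integral_cong) (auto simp: kN space)
      finally show ?thesis by simp
    qed
    have 2: "(\<integral>z. (\<lambda>(x, y). k x y * f y) z \<partial>(M \<Otimes>\<^sub>M N)) = n * (\<integral>x. f x \<partial>N)"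
    proof -
      have "(\<integral>z. (\<lambda>(x, y). k x y * f y) z \<partial>(M \<Otimes>\<^sub>M N)) = (\<integral>y. (\<integral>x. k x y * f y \<partial>M) \<partial>N)"
        using P.integral_snd[OF I(3)] by simp
      also have "\<dots> = (\<integral>y. n * f y \<partial>N)"
        by (intro Bochner_Integration.integral_cong) (auto simp: kM space mn)
      finally show ?thesis by simp
    qed
    have 3: "(\<integral>z. (\<lambda>(x, y). k x y) z \<partial>(M \<Otimes>\<^sub>M N)) = n"
      using P.integral_fst'[OF I(1)]
        Bochner_Integration.integral_cong[OF refl, of M "\<lambda>x. \<integral>y. k x y \<partial>N" "\<lambda>_. n"]
      by (simp add: kN space(1) M.prob_space[unfolded space(1)])
    have "\<bar>n * (\<integral>x. f x \<partial>M) - n * (\<integral>x. f x \<partial>N)\<bar>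
        = \<bar>\<integral>z. (\<lambda>(x, y). k x y * f x) z - (\<lambda>(x, y). k x y * f y) z \<partial>(M \<Otimes>\<^sub>M N)\<bar>"
      unfolding 1[symmetric] 2[symmetric]
      by (subst Bochner_Integration.integral_diff[OF I(2,3)]) (rule refl)
    also have "\<dots> \<le> (\<integral>z. \<bar>(\<lambda>(x, y). k x y * f x) z - (\<lambda>(x, y). k x y * f y) z\<bar> \<partial>(M \<Otimes>\<^sub>M N))"
      by (rule integral_abs_bound)
    also have "\<dots> \<le> (\<integral>z. L * e * (\<lambda>(x, y). k x y) z \<partial>(M \<Otimes>\<^sub>M N))"
    proof (rule integral_mono)
      fix z :: "(real ^ 'p) \<times> (real ^ 'p)"
      obtain x y where z: "z = (x, y)" by force
      have "\<bar>k x y * f x - k x y * f y\<bar> = k x y * \<bar>f x - f y\<bar>"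
        using kb(2)[of x y] by (simp add: abs_mult flip: right_diff_distrib)
      also have "\<dots> \<le> L * e * k x y"
      proof (cases "dist x y < e")
        case True
        then have "L * dist x y \<le> L * e" using L by (intro mult_left_mono) auto
        with True show ?thesis using lip[of x y] by (simp add: k_def)
      qed (simp add: k_def)
      finally show "\<bar>(\<lambda>(x, y). k x y * f x) z - (\<lambda>(x, y). k x y * f y) z\<bar> \<le> L * e * (\<lambda>(x, y). k x y) z"
        by (simp add: z)
    next
      show "integrable (M \<Otimes>\<^sub>M N) (\<lambda>z. \<bar>(\<lambda>(x, y). k x y * f x) z - (\<lambda>(x, y). k x y * f y) z\<bar>)"
        by (rule integrable_abs[OF Bochner_Integration.integrable_diff[OF I(2,3)]])
      show "integrable (M \<Otimes>\<^sub>M N) (\<lambda>z. L * e * (\<lambda>(x, y). k x y) z)"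
        by (rule integrable_mult_right[OF I(1)])
    qed
    also have "\<dots> = n * (L * e)" using 3 by simp
    finally have "n * \<bar>(\<integral>x. f x \<partial>M) - (\<integral>x. f x \<partial>N)\<bar> \<le> n * (L * e)"
      using n by (simp add: abs_mult flip: right_diff_distrib)
    then show ?thesis using n by simp
  qed
  have "\<bar>(\<integral>x. f x \<partial>M) - (\<integral>x. f x \<partial>N)\<bar> \<le> 0 + d" if "d > 0" for d
  proof -
    have "L * (d / (L + 1)) \<le> d" using L that by (simp add: field_simps)
    then show ?thesis using main[of "d / (L + 1)"] L that by simp
  qed
  then have "\<bar>(\<integral>x. f x \<partial>M) - (\<integral>x. f x \<partial>N)\<bar> \<le> 0" by (rule field_le_epsilon)
  then show ?thesis by simp
qed

lemma rotation_invariant_prob_unique: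
  fixes M N :: "(real ^ 'p::finite) measure"
  assumes M: "rotation_invariant_prob M" and N: "rotation_invariant_prob N"
  shows "M = N"
proof -
  have closed: "(\<lambda>n. \<integral>x. max 0 (1 - real n * infdist x C) \<partial>V) \<longlonglongrightarrow> measure V (C \<inter> sphere 0 1)"
    if V: "rotation_invariant_prob V" and C: "closed C" "C \<noteq> {}" for V and C :: "(real ^ 'p) set"
  proof -
    interpret V: prob_space V using V by (simp add: rotation_invariant_prob_def)
    have sets: "sets V = sets (restrict_space borel (sphere 0 1))"
      using V by (simp add: rotation_invariant_prob_def)
    have space: "space V = sphere 0 1"
      using sets_eq_imp_space_eq[OF sets] by (simp add: space_restrict_space)
    have idV: "(\<lambda>x. x) \<in> borel_measurable V"
      using measurable_restrict_space1[OF measurable_ident[unfolded id_def], of borel "sphere (0 :: real ^ 'p) 1"]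
      by (simp add: sets cong: measurable_cong_sets)
    have inf[measurable]: "(\<lambda>x. infdist x C) \<in> borel_measurable V"
      by (rule measurable_compose[OF idV]) (intro borel_measurable_continuous_onI continuous_intros)
    have CV: "C \<inter> sphere 0 1 \<in> Sigma_Algebra.sets V" using C by (auto simp: sets sets_restrict_space)
    have "(\<lambda>n. \<integral>x. max 0 (1 - real n * infdist x C) \<partial>V) \<longlonglongrightarrow> (\<integral>x. indicator (C \<inter> sphere 0 1) x \<partial>V)"
    proof (rule integral_dominated_convergence[where w = "\<lambda>_. 1"])
      show "AE x in V. (\<lambda>n. max 0 (1 - real n * infdist x C)) \<longlonglongrightarrow> indicator (C \<inter> sphere 0 1) x"
      proof (rule AE_I2)
        fix x assume x: "x \<in> Sigma_Algebra.space V"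
        show "(\<lambda>n. max 0 (1 - real n * infdist x C)) \<longlonglongrightarrow> indicator (C \<inter> sphere 0 1) x"
        proof (cases "x \<in> C")
          case True
          then show ?thesis using x by (simp add: space)
        next
          case False
          then have pos: "infdist x C > 0" using C by (intro infdist_pos_not_in_closed)
          obtain n0 :: nat where n0: "1 < real n0 * infdist x C"
            using reals_Archimedean3[OF pos] by blast
          have "1 - real n * infdist x C \<le> 0" if "n \<ge> n0" for n
            using n0 that pos mult_right_mono[of "real n0" "real n" "infdist x C"] by linarith
          then have "eventually (\<lambda>n. max 0 (1 - real n * infdist x C) = 0) sequentially"
            by (intro eventually_sequentiallyI[of n0]) auto
          then show ?thesis using False by (simp add: tendsto_eventually)
        qed
      qed
    qed (use CV in \<open>auto simp: infdist_nonneg\<close>)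
    then show ?thesis using sets.sets_into_space[OF CV] by (simp add: Int_absorb2)
  qed
  have fins: "prob_space M" "prob_space N" and sets:
      "sets M = sets (restrict_space borel (sphere 0 1))" "sets N = sets (restrict_space borel (sphere 0 1))"
    using M N by (auto simp: rotation_invariant_prob_def)
  interpret M: prob_space M by fact
  interpret N: prob_space N by fact
  have eq: "measure M (C \<inter> sphere 0 1) = measure N (C \<inter> sphere 0 1)" if C: "closed C" for C
  proof (cases "C = {}")
    case False
    have "(\<integral>x. max 0 (1 - real n * infdist x C) \<partial>M) = (\<integral>x. max 0 (1 - real n * infdist x C) \<partial>N)" for n
    proof (rule rotation_invariant_prob_integral[OF M N, where L = "real n"])
      fix x y :: "real ^ 'p"
      have "\<bar>real n * infdist x C - real n * infdist y C\<bar> \<le> real n * dist x y"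
        using infdist_triangle_abs[of x C y] by (simp add: abs_mult mult_left_mono flip: right_diff_distrib)
      then show "\<bar>max 0 (1 - real n * infdist x C) - max 0 (1 - real n * infdist y C)\<bar> \<le> real n * dist x y"
        by linarith
      show "\<bar>max 0 (1 - real n * infdist x C)\<bar> \<le> 1"
        by (simp add: infdist_nonneg)
    qed (intro borel_measurable_continuous_onI continuous_intros)
    then show ?thesis
      using closed[OF M C False] closed[OF N C False] LIMSEQ_unique by auto
  qed simp
  let ?S = "sphere (0 :: real ^ 'p) 1"
  let ?E = "(\<lambda>C. C \<inter> ?S) ` {C. closed C}"
  have gen: "sets (restrict_space borel ?S) = sigma_sets ?S ?E"
  proof -
    have "sets (borel :: (real ^ 'p) measure) = sigma_sets UNIV {C. closed C}"
      by (simp add: borel_eq_closed)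
    then have "sets (restrict_space borel ?S) = (\<inter>) ?S ` sigma_sets UNIV {C. closed C}"
      by (simp add: sets_restrict_space)
    also have "\<dots> = (\<lambda>C. C \<inter> ?S) ` sigma_sets UNIV {C. closed C}"
      by (simp add: Int_commute)
    also have "\<dots> = sigma_sets ?S ?E"
    proof -
      have "?S \<in> sigma_sets UNIV {C. closed C}" by (intro sigma_sets.Basic) simp
      from sigma_sets_Int[OF this] show ?thesis by (simp add: Int_commute)
    qed
    finally show ?thesis .
  qed
  show ?thesis
  proof (rule measure_eqI_generator_eq[where E = ?E and \<Omega> = ?S and A = "\<lambda>_. ?S"])
    show "Int_stable ?E"
    proof (rule Int_stableI_image)
      fix C D :: "(real ^ 'p) set" assume "C \<in> {C. closed C}" "D \<in> {C. closed C}"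
      then show "\<exists>F\<in>{C. closed C}. C \<inter> ?S \<inter> (D \<inter> ?S) = F \<inter> ?S"
        by (intro bexI[of _ "C \<inter> D"]) auto
    qed
  next
    fix X assume "X \<in> ?E"
    then show "emeasure M X = emeasure N X"
      using eq by (auto simp: M.emeasure_eq_measure N.emeasure_eq_measure)
  qed (auto simp: sets gen image_iff)
qed

lemma rotation_invariant_prob_sphere_haar: "rotation_invariant_prob sphere_haar"
  unfolding sphere_haar_def
  using ex_rotation_invariant_prob rotation_invariant_prob_unique by (metis theI)


section \<open>The metrics and the depth\<close>

abbreviation unit_lebesgue :: "real measure" where
  "unit_lebesgue \<equiv> restrict_space lborel {0..1}"

definition rho :: "real \<Rightarrow> 'p::finite fuzzy \<Rightarrow> 'p fuzzy \<Rightarrow> real" where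
  "rho r A B =
     (\<integral>\<alpha>. (\<integral>u. \<bar>support_fun A (u, \<alpha>) - support_fun B (u, \<alpha>)\<bar> powr r \<partial>sphere_haar)
        \<partial>unit_lebesgue) powr (1 / r)"

definition natural_depth :: "real \<Rightarrow> 'w measure \<Rightarrow> 'p::finite fuzzy \<Rightarrow> ('w \<Rightarrow> 'p fuzzy) \<Rightarrow> real" where
  "natural_depth r M A X = inverse (1 + (\<integral>\<omega>. rho r A (X \<omega>) \<partial>M))"


section \<open>The spaces of classes of r-integrable functions\<close>

definition Lr_fun :: "real \<Rightarrow> 'a measure \<Rightarrow> ('a \<Rightarrow> real) set" where
  "Lr_fun r N = {f \<in> borel_measurable N. integrable N (\<lambda>x. \<bar>f x\<bar> powr r)}"

definition Lr_norm :: "real \<Rightarrow> 'a measure \<Rightarrow> ('a \<Rightarrow> real) \<Rightarrow> real" where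
  "Lr_norm r N f = (\<integral>x. \<bar>f x\<bar> powr r \<partial>N) powr (1 / r)"

definition Lr_class :: "real \<Rightarrow> 'a measure \<Rightarrow> ('a \<Rightarrow> real) \<Rightarrow> ('a \<Rightarrow> real) set" where
  "Lr_class r N f = {g \<in> Lr_fun r N. AE x in N. g x = f x}"

definition Lr_space :: "real \<Rightarrow> 'a measure \<Rightarrow> ('a \<Rightarrow> real) set set" where
  "Lr_space r N = Lr_class r N ` Lr_fun r N"

definition Lr_dist :: "real \<Rightarrow> 'a measure \<Rightarrow> ('a \<Rightarrow> real) set \<Rightarrow> ('a \<Rightarrow> real) set \<Rightarrow> real" where
  "Lr_dist r N F G = Lr_norm r N (\<lambda>x. (SOME f. f \<in> F) x - (SOME g. g \<in> G) x)"

lemma powr_convex_combination: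
  fixes a b t r :: real
  assumes "r \<ge> 1" "a \<ge> 0" "b \<ge> 0" "0 \<le> t" "t \<le> 1"
  shows "(t * a + (1 - t) * b) powr r \<le> t * a powr r + (1 - t) * b powr r"
proof -
  have le: "(s * c) powr r \<le> s * c powr r" if "0 \<le> s" "s \<le> 1" "c \<ge> 0" for s c :: real
  proof -
    have "s powr r \<le> s"
      using that assms powr_mono'[of 1 r s] by (cases "s = 0") auto
    then show ?thesis
      using that by (simp add: powr_mult mult_right_mono)
  qed
  show ?thesis
  proof (cases "a = 0 \<or> b = 0")
    case True
    then show ?thesis
      using le[of t a] le[of "1 - t" b] assms by auto
  next
    case False
    then show ?thesis
      using convex_onD[OF powr_convex[OF assms(1)], of t b a] assms by (simp add: algebra_simps)
  qed
qed

lemma Lr_fun_minus: "f \<in> Lr_fun r N \<Longrightarrow> (\<lambda>x. - f x) \<in> Lr_fun r N"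
  by (auto simp: Lr_fun_def)

lemma Lr_fun_add:
  assumes "r \<ge> 1" "f \<in> Lr_fun r N" "g \<in> Lr_fun r N"
  shows "(\<lambda>x. f x + g x) \<in> Lr_fun r N"
proof -
  have [measurable]: "f \<in> borel_measurable N" "g \<in> borel_measurable N"
    using assms by (auto simp: Lr_fun_def)
  have le: "\<bar>f x + g x\<bar> powr r \<le> 2 powr r * (\<bar>f x\<bar> powr r + \<bar>g x\<bar> powr r)" for x
  proof -
    have "\<bar>f x + g x\<bar> powr r \<le> (2 * (1/2 * \<bar>f x\<bar> + (1 - 1/2) * \<bar>g x\<bar>)) powr r"
      using assms by (intro powr_mono2) auto
    also have "\<dots> = 2 powr r * (1/2 * \<bar>f x\<bar> + (1 - 1/2) * \<bar>g x\<bar>) powr r"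
      by (subst powr_mult) auto
    also have "\<dots> \<le> 2 powr r * (1/2 * \<bar>f x\<bar> powr r + (1 - 1/2) * \<bar>g x\<bar> powr r)"
      using assms by (intro mult_left_mono powr_convex_combination) auto
    also have "\<dots> \<le> 2 powr r * (\<bar>f x\<bar> powr r + \<bar>g x\<bar> powr r)"
      by (intro mult_left_mono add_mono) auto
    finally show ?thesis .
  qed
  have "integrable N (\<lambda>x. 2 powr r * (\<bar>f x\<bar> powr r + \<bar>g x\<bar> powr r))"
    using assms by (auto simp: Lr_fun_def)
  then have "integrable N (\<lambda>x. \<bar>f x + g x\<bar> powr r)"
    by (rule Bochner_Integration.integrable_bound) (use le in \<open>auto intro!: AE_I2\<close>)
  then show ?thesis
    by (auto simp: Lr_fun_def)
qed

lemma Lr_fun_diff: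
  "r \<ge> 1 \<Longrightarrow> f \<in> Lr_fun r N \<Longrightarrow> g \<in> Lr_fun r N \<Longrightarrow> (\<lambda>x. f x - g x) \<in> Lr_fun r N"
  using Lr_fun_add[of r f N "\<lambda>x. - g x"] Lr_fun_minus[of g r N] by simp

lemma Lr_norm_nonneg: "0 \<le> Lr_norm r N f"
  by (simp add: Lr_norm_def)

lemma Lr_norm_cong_AE:
  assumes "f \<in> Lr_fun r N" "g \<in> Lr_fun r N" "AE x in N. f x = g x"
  shows "Lr_norm r N f = Lr_norm r N g"
proof -
  have "(\<integral>x. \<bar>f x\<bar> powr r \<partial>N) = (\<integral>x. \<bar>g x\<bar> powr r \<partial>N)"
    using assms by (intro integral_cong_AE) (auto simp: Lr_fun_def)
  then show ?thesis by (simp add: Lr_norm_def)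
qed

lemma Lr_norm_eq_0_iff:
  assumes "r \<ge> 1" "f \<in> Lr_fun r N"
  shows "Lr_norm r N f = 0 \<longleftrightarrow> (AE x in N. f x = 0)"
  using assms integral_nonneg_eq_0_iff_AE[of N "\<lambda>x. \<bar>f x\<bar> powr r"]
  by (auto simp: Lr_norm_def Lr_fun_def)

lemma Lr_norm_powr:
  assumes "r \<ge> 1"
  shows "Lr_norm r N f powr r = (\<integral>x. \<bar>f x\<bar> powr r \<partial>N)"
  using assms by (simp add: Lr_norm_def powr_powr)

lemma Lr_norm_triangle:
  assumes r: "r \<ge> 1" and f: "f \<in> Lr_fun r N" and g: "g \<in> Lr_fun r N"
  shows "Lr_norm r N (\<lambda>x. f x + g x) \<le> Lr_norm r N f + Lr_norm r N g"
proof -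
  define a b where "a = Lr_norm r N f" and "b = Lr_norm r N g"
  have fg: "(\<lambda>x. f x + g x) \<in> Lr_fun r N"
    by (rule Lr_fun_add[OF assms])
  consider "a = 0" | "b = 0" | "a > 0" "b > 0"
    using Lr_norm_nonneg[of r N f] Lr_norm_nonneg[of r N g] unfolding a_def b_def by linarith
  then show ?thesis
  proof cases
    case 1
    then have "AE x in N. f x = 0"
      using Lr_norm_eq_0_iff[OF r f] by (simp add: a_def)
    then have "Lr_norm r N (\<lambda>x. f x + g x) = Lr_norm r N g"
      by (intro Lr_norm_cong_AE fg g) auto
    then show ?thesis using Lr_norm_nonneg[of r N f] by simp
  next
    case 2
    then have "AE x in N. g x = 0"
      using Lr_norm_eq_0_iff[OF r g] by (simp add: b_def)
    then have "Lr_norm r N (\<lambda>x. f x + g x) = Lr_norm r N f"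
      by (intro Lr_norm_cong_AE fg f) auto
    then show ?thesis using Lr_norm_nonneg[of r N g] by simp
  next
    case 3
    define t where "t = a / (a + b)"
    have t: "0 \<le> t" "t \<le> 1" and t': "1 - t = b / (a + b)"
      using 3 by (auto simp: t_def field_simps)
    have If: "integrable N (\<lambda>x. \<bar>f x\<bar> powr r)" and Ig: "integrable N (\<lambda>x. \<bar>g x\<bar> powr r)"
      and Ifg: "integrable N (\<lambda>x. \<bar>f x + g x\<bar> powr r)"
      using f g fg by (auto simp: Lr_fun_def)
    have le: "\<bar>f x + g x\<bar> powr r / (a + b) powr r
        \<le> t / a powr r * \<bar>f x\<bar> powr r + (1 - t) / b powr r * \<bar>g x\<bar> powr r" for x
    proof -
      have eq: "t * (\<bar>f x\<bar> / a) + (1 - t) * (\<bar>g x\<bar> / b) = (\<bar>f x\<bar> + \<bar>g x\<bar>) / (a + b)"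
      proof -
        have "t * (\<bar>f x\<bar> / a) = \<bar>f x\<bar> / (a + b)" "(1 - t) * (\<bar>g x\<bar> / b) = \<bar>g x\<bar> / (a + b)"
          unfolding t' unfolding t_def using 3 by simp_all
        then show ?thesis by (simp add: add_divide_distrib)
      qed
      have "\<bar>f x + g x\<bar> powr r / (a + b) powr r = (\<bar>f x + g x\<bar> / (a + b)) powr r"
        using 3 by (simp add: powr_divide)
      also have "\<dots> \<le> (t * (\<bar>f x\<bar> / a) + (1 - t) * (\<bar>g x\<bar> / b)) powr r"
        unfolding eq using 3 r by (intro powr_mono2 divide_right_mono) auto
      also have "\<dots> \<le> t * (\<bar>f x\<bar> / a) powr r + (1 - t) * (\<bar>g x\<bar> / b) powr r"
        using 3 r t by (intro powr_convex_combination) auto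
      finally show ?thesis
        using 3 by (simp add: powr_divide)
    qed
    have ab: "a powr r > 0" "b powr r > 0" "(a + b) powr r > 0"
      using 3 by auto
    have "(\<integral>x. \<bar>f x + g x\<bar> powr r / (a + b) powr r \<partial>N)
        \<le> (\<integral>x. t / a powr r * \<bar>f x\<bar> powr r + (1 - t) / b powr r * \<bar>g x\<bar> powr r \<partial>N)"
      using If Ig Ifg le by (intro integral_mono) auto
    also have "\<dots> = t / a powr r * a powr r + (1 - t) / b powr r * b powr r"
      using If Ig Lr_norm_powr[OF r, of N f] Lr_norm_powr[OF r, of N g]
      by (simp add: a_def b_def)
    also have "\<dots> = 1"
      using ab by simp
    finally have "(\<integral>x. \<bar>f x + g x\<bar> powr r \<partial>N) \<le> (a + b) powr r"
      using ab by (simp add: field_simps)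
    then have "Lr_norm r N (\<lambda>x. f x + g x) \<le> ((a + b) powr r) powr (1 / r)"
      unfolding Lr_norm_def using r by (intro powr_mono2) auto
    also have "\<dots> = a + b"
      using 3 r by (simp add: powr_powr)
    finally show ?thesis by (simp add: a_def b_def)
  qed
qed

lemma Lr_dist_class:
  assumes r: "r \<ge> 1" and f: "f \<in> Lr_fun r N" and g: "g \<in> Lr_fun r N"
  shows "Lr_dist r N (Lr_class r N f) (Lr_class r N g) = Lr_norm r N (\<lambda>x. f x - g x)"
proof -
  define f' g' where "f' = (SOME h. h \<in> Lr_class r N f)" and "g' = (SOME h. h \<in> Lr_class r N g)"
  have "f \<in> Lr_class r N f" "g \<in> Lr_class r N g"
    using f g by (auto simp: Lr_class_def)
  then have "f' \<in> Lr_class r N f" "g' \<in> Lr_class r N g"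
    unfolding f'_def g'_def by (metis someI)+
  then have "f' \<in> Lr_fun r N" "g' \<in> Lr_fun r N" "AE x in N. f' x = f x" "AE x in N. g' x = g x"
    by (auto simp: Lr_class_def)
  then have "Lr_norm r N (\<lambda>x. f' x - g' x) = Lr_norm r N (\<lambda>x. f x - g x)"
    using r f g by (intro Lr_norm_cong_AE Lr_fun_diff) auto
  then show ?thesis by (simp add: Lr_dist_def f'_def g'_def)
qed

lemma Lr_class_eq_iff:
  assumes "f \<in> Lr_fun r N" "g \<in> Lr_fun r N"
  shows "Lr_class r N f = Lr_class r N g \<longleftrightarrow> (AE x in N. f x = g x)"
proof
  assume "Lr_class r N f = Lr_class r N g"
  then have "f \<in> Lr_class r N g"
    using assms by (auto simp: Lr_class_def)
  then show "AE x in N. f x = g x" by (auto simp: Lr_class_def)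
qed (auto simp: Lr_class_def)

lemma Metric_space_Lr:
  assumes r: "r \<ge> 1"
  shows "Metric_space (Lr_space r N) (Lr_dist r N)"
proof
  fix F G :: "('a \<Rightarrow> real) set"
  show "0 \<le> Lr_dist r N F G"
    by (simp add: Lr_dist_def Lr_norm_nonneg)
  show "Lr_dist r N F G = Lr_dist r N G F"
    unfolding Lr_dist_def Lr_norm_def by (simp add: abs_minus_commute)
next
  fix F G assume "F \<in> Lr_space r N" "G \<in> Lr_space r N"
  then obtain f g where fg: "f \<in> Lr_fun r N" "g \<in> Lr_fun r N"
    and [simp]: "F = Lr_class r N f" "G = Lr_class r N g"
    by (auto simp: Lr_space_def)
  show "Lr_dist r N F G = 0 \<longleftrightarrow> F = G"
    using fg r by (simp add: Lr_dist_class Lr_norm_eq_0_iff Lr_fun_diff Lr_class_eq_iff)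
next
  fix F G H assume "F \<in> Lr_space r N" "G \<in> Lr_space r N" "H \<in> Lr_space r N"
  then obtain f g h where fgh: "f \<in> Lr_fun r N" "g \<in> Lr_fun r N" "h \<in> Lr_fun r N"
    and [simp]: "F = Lr_class r N f" "G = Lr_class r N g" "H = Lr_class r N h"
    by (auto simp: Lr_space_def)
  show "Lr_dist r N F H \<le> Lr_dist r N F G + Lr_dist r N G H"
    using Lr_norm_triangle[OF r Lr_fun_diff[OF r fgh(1,2)] Lr_fun_diff[OF r fgh(2,3)]] fgh r
    by (simp add: Lr_dist_class)
qed


section \<open>Functional symmetry\<close>

text \<open>Measurability is part of being a random element. For support functions of fuzzy random
  variables, as elements of the separable space of classes of r-integrable functions, it always
  holds. The notion of functional symmetry does not depend on the exponent \<open>r \<ge> 1\<close>.\<close>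

definition identically_distributed ::
    "'w measure \<Rightarrow> 'e measure \<Rightarrow> ('w \<Rightarrow> 'e) \<Rightarrow> ('w \<Rightarrow> 'e) \<Rightarrow> bool" where
  "identically_distributed M E Y Z \<longleftrightarrow>
     Y \<in> measurable M E \<and> Z \<in> measurable M E \<and> distr M E Y = distr M E Z"

definition functionally_symmetric ::
    "real \<Rightarrow> 'w measure \<Rightarrow> ('w \<Rightarrow> 'p::finite fuzzy) \<Rightarrow> 'p fuzzy \<Rightarrow> bool" where
  "functionally_symmetric r M X A \<longleftrightarrow>
     (let N = sphere_haar \<Otimes>\<^sub>M unit_lebesgue in
      identically_distributed M (metric_borel (Lr_space r N) (Lr_dist r N))
        (\<lambda>\<omega>. Lr_class r N (\<lambda>z. support_fun (X \<omega>) z - support_fun A z))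
        (\<lambda>\<omega>. Lr_class r N (\<lambda>z. support_fun A z - support_fun (X \<omega>) z)))"

end

theory Submission
  imports Defs
begin

text \<open>
  Passing to support functions turns \<^const>\<open>rho\<close> into a norm distance: by Fubini,
  \<open>\<rho>\<^sub>r(A, B)\<close> is the norm of \<open>s\<^sub>A - s\<^sub>B\<close> in the space \<open>L\<^sup>r\<close> over the product of the sphere and the
  unit interval (\<open>rho_eq_Lr_norm\<close>). Write \<open>Y = s\<^sub>X - s\<^sub>U\<close> and \<open>h = s\<^sub>B - s\<^sub>U\<close>, so that
  \<open>\<rho>\<^sub>r(U, X) = \<parallel>Y\<parallel>\<close> and \<open>\<rho>\<^sub>r(B, X) = \<parallel>Y - h\<parallel>\<close>. The triangle inequality gives
  \<open>2 \<parallel>Y\<parallel> \<le> \<parallel>Y - h\<parallel> + \<parallel>- Y - h\<parallel>\<close>, and functional symmetry says that \<open>Y\<close> and \<open>- Y\<close> have the same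
  distribution, so the two terms on the right have the same expectation. Hence
  \<open>E \<rho>\<^sub>r(U, X) \<le> E \<rho>\<^sub>r(B, X)\<close> for every \<open>B\<close>, and the depth, which is decreasing in this
  expectation, attains its supremum at \<open>U\<close>.

  This argument lives in any space \<open>L\<^sup>r\<close> and is \<open>symmetric_random_element_centre_minimal\<close>. What is
  specific to fuzzy sets is that support functions are elements of \<open>L\<^sup>r\<close>, and that
  \<open>\<rho>\<^sub>r(B, X)\<close> has a finite expectation. Both rest on the bound \<open>\<bar>s\<^sub>A\<bar> \<le> \<parallel>A\<^sub>0\<parallel>\<close>, and the first also on
  joint measurability of \<open>s\<^sub>A\<close>, which is Lipschitz in the direction and decreasing in the level.
\<close>

section \<open>Symmetric random elements of a space of r-integrable functions\<close>

lemma Lr_norm_uminus: "Lr_norm r N (\<lambda>x. - f x) = Lr_norm r N f"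
  by (simp add: Lr_norm_def)

text \<open>The vector \<open>f\<close> is the midpoint of \<open>f - h\<close> and \<open>f + h\<close>. The norm of \<open>f + h\<close> appears as that of
  \<open>- f - h\<close>, the distance of the reflected vector \<open>- f\<close> from \<open>h\<close>.\<close>

lemma Lr_norm_twice_le:
  assumes r: "1 \<le> r" and f: "f \<in> Lr_fun r N" and h: "h \<in> Lr_fun r N"
  shows "2 * Lr_norm r N f \<le> Lr_norm r N (\<lambda>x. f x - h x) + Lr_norm r N (\<lambda>x. - f x - h x)"
proof -
  have "2 * Lr_norm r N f = Lr_norm r N (\<lambda>x. 2 * f x)"
  proof -
    have "(\<integral>x. \<bar>2 * f x\<bar> powr r \<partial>N) = 2 powr r * (\<integral>x. \<bar>f x\<bar> powr r \<partial>N)"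
      by (subst integral_mult_right_zero[symmetric]) (simp only: abs_mult abs_numeral powr_mult[of 2])
    moreover have "(2 powr r * I) powr (1 / r) = 2 * I powr (1 / r)" for I :: real
      using r by (subst powr_mult) (simp_all add: powr_powr)
    ultimately show ?thesis
      by (simp only: Lr_norm_def)
  qed
  also have "\<dots> = Lr_norm r N (\<lambda>x. (f x - h x) + (f x + h x))"
    by simp
  also have "\<dots> \<le> Lr_norm r N (\<lambda>x. f x - h x) + Lr_norm r N (\<lambda>x. f x + h x)"
    by (intro Lr_norm_triangle Lr_fun_diff Lr_fun_add r f h)
  also have "Lr_norm r N (\<lambda>x. f x + h x) = Lr_norm r N (\<lambda>x. - f x - h x)"
    using Lr_norm_uminus[of r N "\<lambda>x. f x + h x"] by simp
  finally show ?thesis .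
qed

text \<open>The sublevel sets of the distance from \<open>a\<close> are open balls.\<close>

lemma measurable_metric_dist:
  assumes "Metric_space S d" and a: "a \<in> S"
  shows "d a \<in> borel_measurable (metric_borel S d)"
proof -
  interpret Metric_space S d by fact
  have sp: "space (metric_borel S d) = S"
    unfolding metric_borel_def by (simp add: space_measure_of_conv)
  have "{w \<in> space (metric_borel S d). d a w < c} \<in> sets (metric_borel S d)" for c
  proof -
    have "{w \<in> space (metric_borel S d). d a w < c} = mball a c"
      using a by (auto simp: sp)
    moreover have "{U. openin mtopology U} \<subseteq> Pow S"
      using openin_subset by force
    ultimately show ?thesis
      unfolding metric_borel_def by (auto intro!: in_measure_of)
  qed
  then show ?thesis
    by (simp add: borel_measurable_iff_less)
qed

text \<open>Measurability of \<open>y\<close> as a random element of \<open>L\<^sup>r\<close> transfers to distances, since the distance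
  from the class of \<open>h\<close> is a Borel function on that space.\<close>

lemma measurable_Lr_norm_diff:
  assumes r: "1 \<le> r" and h: "h \<in> Lr_fun r N"
    and y: "\<And>\<omega>. \<omega> \<in> space M \<Longrightarrow> y \<omega> \<in> Lr_fun r N"
    and Y: "(\<lambda>\<omega>. Lr_class r N (y \<omega>)) \<in> measurable M (metric_borel (Lr_space r N) (Lr_dist r N))"
  shows "(\<lambda>\<omega>. Lr_norm r N (\<lambda>x. y \<omega> x - h x)) \<in> borel_measurable M"
proof -
  interpret L: Metric_space "Lr_space r N" "Lr_dist r N"
    by (rule Metric_space_Lr[OF r])
  have "Lr_class r N h \<in> Lr_space r N"
    using h by (auto simp: Lr_space_def)
  from measurable_compose[OF Y measurable_metric_dist[OF L.Metric_space_axioms this]]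
  have "(\<lambda>\<omega>. Lr_dist r N (Lr_class r N h) (Lr_class r N (y \<omega>))) \<in> borel_measurable M" .
  then show ?thesis
    by (rule measurable_cong[THEN iffD1, rotated])
       (simp add: L.commute[of "Lr_class r N h"] Lr_dist_class r h y)
qed

text \<open>A symmetric random element is on average at least as close to \<open>0\<close> as to any other \<open>h\<close>: average
  the midpoint inequality over \<open>\<omega>\<close>. The two summands on its right are the same function, the
  distance from \<open>h\<close>, evaluated at \<open>y\<close> and at \<open>- y\<close>, so symmetry makes their expectations equal.\<close>

lemma symmetric_random_element_centre_minimal:
  assumes r: "1 \<le> r" and h: "h \<in> Lr_fun r N"
    and y: "\<And>\<omega>. \<omega> \<in> space M \<Longrightarrow> y \<omega> \<in> Lr_fun r N"
    and sym: "identically_distributed M (metric_borel (Lr_space r N) (Lr_dist r N))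
        (\<lambda>\<omega>. Lr_class r N (y \<omega>)) (\<lambda>\<omega>. Lr_class r N (\<lambda>x. - y \<omega> x))"
    and int: "integrable M (\<lambda>\<omega>. Lr_norm r N (\<lambda>x. y \<omega> x - h x))"
  shows "(\<integral>\<omega>. Lr_norm r N (y \<omega>) \<partial>M) \<le> (\<integral>\<omega>. Lr_norm r N (\<lambda>x. y \<omega> x - h x) \<partial>M)"
proof -
  let ?E = "metric_borel (Lr_space r N) (Lr_dist r N)"
  let ?d = "Lr_dist r N (Lr_class r N h)"
  interpret L: Metric_space "Lr_space r N" "Lr_dist r N"
    by (rule Metric_space_Lr[OF r])
  have Y: "(\<lambda>\<omega>. Lr_class r N (y \<omega>)) \<in> measurable M ?E"
    and Z: "(\<lambda>\<omega>. Lr_class r N (\<lambda>x. - y \<omega> x)) \<in> measurable M ?E"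
    and eq: "distr M ?E (\<lambda>\<omega>. Lr_class r N (y \<omega>)) = distr M ?E (\<lambda>\<omega>. Lr_class r N (\<lambda>x. - y \<omega> x))"
    using sym by (auto simp: identically_distributed_def)
  have d: "?d \<in> borel_measurable ?E"
    using h by (intro measurable_metric_dist L.Metric_space_axioms) (auto simp: Lr_space_def)
  have dY: "?d (Lr_class r N (y \<omega>)) = Lr_norm r N (\<lambda>x. y \<omega> x - h x)" if "\<omega> \<in> space M" for \<omega>
    by (simp add: L.commute[of "Lr_class r N h"] Lr_dist_class r h y that)
  have dZ: "?d (Lr_class r N (\<lambda>x. - y \<omega> x)) = Lr_norm r N (\<lambda>x. - y \<omega> x - h x)"
    if "\<omega> \<in> space M" for \<omega>
    by (simp add: L.commute[of "Lr_class r N h"] Lr_dist_class r h y that Lr_fun_minus)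
  \<comment> \<open>Both integrability and the value of the integral of \<open>?d\<close> depend on the distribution only.\<close>
  have "integrable M (\<lambda>\<omega>. ?d (Lr_class r N (y \<omega>)))"
    using int by (simp add: dY cong: Bochner_Integration.integrable_cong)
  then have "integrable M (\<lambda>\<omega>. ?d (Lr_class r N (\<lambda>x. - y \<omega> x)))"
    using integrable_distr_eq[OF Y d] integrable_distr_eq[OF Z d] eq by simp
  then have int': "integrable M (\<lambda>\<omega>. Lr_norm r N (\<lambda>x. - y \<omega> x - h x))"
    by (simp add: dZ cong: Bochner_Integration.integrable_cong)
  have "(\<integral>\<omega>. ?d (Lr_class r N (y \<omega>)) \<partial>M) = (\<integral>\<omega>. ?d (Lr_class r N (\<lambda>x. - y \<omega> x)) \<partial>M)"
    using integral_distr[OF Y d] integral_distr[OF Z d] eq by simp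
  then have same: "(\<integral>\<omega>. Lr_norm r N (\<lambda>x. y \<omega> x - h x) \<partial>M)
      = (\<integral>\<omega>. Lr_norm r N (\<lambda>x. - y \<omega> x - h x) \<partial>M)"
    by (simp add: dY dZ cong: Bochner_Integration.integral_cong)
  have zero: "(\<lambda>_. 0) \<in> Lr_fun r N"
    by (simp add: Lr_fun_def)
  have le: "2 * Lr_norm r N (y \<omega>)
      \<le> Lr_norm r N (\<lambda>x. y \<omega> x - h x) + Lr_norm r N (\<lambda>x. - y \<omega> x - h x)"
    if "\<omega> \<in> space M" for \<omega>
    by (rule Lr_norm_twice_le[OF r y[OF that] h])
  have meas: "(\<lambda>\<omega>. Lr_norm r N (y \<omega>)) \<in> borel_measurable M"
    using measurable_Lr_norm_diff[OF r zero y Y] by simp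
  have "integrable M (\<lambda>\<omega>. Lr_norm r N (y \<omega>))"
  proof (rule Bochner_Integration.integrable_bound[OF
        Bochner_Integration.integrable_add[OF int int'] meas], rule AE_I2)
    fix \<omega> assume "\<omega> \<in> space M"
    from le[OF this] show "norm (Lr_norm r N (y \<omega>))
        \<le> norm (Lr_norm r N (\<lambda>x. y \<omega> x - h x) + Lr_norm r N (\<lambda>x. - y \<omega> x - h x))"
      using Lr_norm_nonneg[of r N "y \<omega>"] by simp
  qed
  then have "(\<integral>\<omega>. 2 * Lr_norm r N (y \<omega>) \<partial>M)
      \<le> (\<integral>\<omega>. Lr_norm r N (\<lambda>x. y \<omega> x - h x) + Lr_norm r N (\<lambda>x. - y \<omega> x - h x) \<partial>M)"
    using int int' le by (intro integral_mono) auto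
  then show ?thesis
    using int int' same by simp
qed


section \<open>Support functions as r-integrable functions\<close>

text \<open>Separate regularity gives joint measurability. If \<open>c < f (u, a)\<close>, then a point \<open>v\<close> of a countable
  dense set and a rational \<open>q > c\<close> witness this: \<open>f (v, a)\<close> exceeds \<open>q\<close> and \<open>v\<close> is so close to \<open>u\<close>
  that moving from \<open>v\<close> to \<open>u\<close> costs less than \<open>q - c\<close>. For fixed \<open>v\<close> and \<open>q\<close> these two
  conditions define a measurable rectangle.\<close>

lemma measurable_pair_Lipschitz:
  fixes f :: "'a::{metric_space, second_countable_topology} \<times> 'b \<Rightarrow> real"
  assumes lip: "\<And>u v a. a \<in> space N \<Longrightarrow> f (u, a) \<le> f (v, a) + K * dist u v"
    and meas: "\<And>u. (\<lambda>a. f (u, a)) \<in> borel_measurable N"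
  shows "f \<in> borel_measurable (borel \<Otimes>\<^sub>M N)"
proof -
  obtain D :: "'a set" where D: "countable D" "\<And>X. open X \<Longrightarrow> X \<noteq> {} \<Longrightarrow> \<exists>d\<in>D. d \<in> X"
    by (rule countable_dense_setE) blast
  have "{z \<in> space (borel \<Otimes>\<^sub>M N). c < f z} \<in> sets (borel \<Otimes>\<^sub>M N)" for c
  proof -
    let ?R = "\<lambda>v q. {u. K * dist u v < q - c} \<times> {a \<in> space N. q < f (v, a)}"
    have opn: "open {u. K * dist u v < s}" for v :: 'a and s
      by (intro open_Collect_less continuous_intros)
    have "{z \<in> space (borel \<Otimes>\<^sub>M N). c < f z} = (\<Union>v\<in>D. \<Union>q\<in>\<rat>. ?R v q)"
    proof (intro equalityI subsetI)
      fix z assume "z \<in> {z \<in> space (borel \<Otimes>\<^sub>M N). c < f z}"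
      then obtain u a where z: "z = (u, a)" and a: "a \<in> space N" and c: "c < f (u, a)"
        by (auto simp: space_pair_measure)
      obtain q where q: "q \<in> \<rat>" "c < q" "q < f (u, a)"
        using Rats_dense_in_real[OF c] by blast
      \<comment> \<open>The first bound keeps \<open>u\<close> in the rectangle of \<open>v\<close> and \<open>q\<close>, the second one yields
        \<open>q < f (v, a)\<close>.\<close>
      have "u \<in> {v. K * dist v u < min (q - c) (f (u, a) - q)}"
        using q by simp
      then obtain v where v: "v \<in> D" "K * dist u v < q - c" "K * dist u v < f (u, a) - q"
        using D(2)[OF opn] by (fastforce simp: dist_commute)
      then have "q < f (v, a)"
        using lip[OF a, of u v] by simp
      then show "z \<in> (\<Union>v\<in>D. \<Union>q\<in>\<rat>. ?R v q)"
        using v q a z by blast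
    next
      fix z assume "z \<in> (\<Union>v\<in>D. \<Union>q\<in>\<rat>. ?R v q)"
      then obtain u a v q where z: "z = (u, a)" "a \<in> space N"
        and *: "K * dist u v < q - c" "q < f (v, a)"
        by auto
      then show "z \<in> {z \<in> space (borel \<Otimes>\<^sub>M N). c < f z}"
        using lip[of a v u] by (auto simp: space_pair_measure dist_commute)
    qed
    also have "\<dots> \<in> sets (borel \<Otimes>\<^sub>M N)"
    proof (intro sets.countable_UN'' D countable_rat pair_measureI)
      show "{a \<in> space N. q < f (v, a)} \<in> sets N" for v q
        using meas[of v] by measurable
    qed (use opn in auto)
    finally show ?thesis .
  qed
  then show ?thesis
    by (simp add: borel_measurable_iff_greater)
qed

lemma
  assumes "A \<in> Fc" "\<alpha> \<in> {0..1}"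
  shows level_nonempty: "level A \<alpha> \<noteq> {}"
    and compact_level: "compact (level A \<alpha>)"
  using assms by (auto simp: Fc_def Kc_def)

text \<open>The level \<open>0\<close> needs its own argument, as it is the closure of the support.\<close>

lemma level_antimono:
  assumes "0 \<le> \<alpha>" "\<alpha> \<le> \<beta>"
  shows "level A \<beta> \<subseteq> level A \<alpha>"
proof (cases "\<alpha> = 0 \<and> \<beta> \<noteq> 0")
  case True
  then have "level A \<beta> \<subseteq> {x. A x > 0}"
    using assms by (auto simp: level_def)
  then have "level A \<beta> \<subseteq> closure {x. A x > 0}"
    using closure_subset by (rule order_trans)
  then show ?thesis
    using True by (simp add: level_def)
qed (use assms in \<open>auto simp: level_def\<close>)

lemma norm_le_Kc_norm: "compact K \<Longrightarrow> x \<in> K \<Longrightarrow> norm x \<le> Kc_norm K"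
  unfolding Kc_norm_def
  by (intro cSUP_upper bounded_imp_bdd_above compact_imp_bounded compact_continuous_image
        continuous_intros)

lemma inner_le_support_fun:
  assumes "A \<in> Fc" "\<alpha> \<in> {0..1}" "v \<in> level A \<alpha>"
  shows "u \<bullet> v \<le> support_fun A (u, \<alpha>)"
  unfolding support_fun_def prod.case
  using assms compact_level
  by (intro cSUP_upper bounded_imp_bdd_above compact_imp_bounded compact_continuous_image
        continuous_intros) auto

lemma support_fun_leI:
  assumes "A \<in> Fc" "\<alpha> \<in> {0..1}" "\<And>v. v \<in> level A \<alpha> \<Longrightarrow> u \<bullet> v \<le> c"
  shows "support_fun A (u, \<alpha>) \<le> c"
  unfolding support_fun_def prod.case
  using assms level_nonempty by (intro cSUP_least) auto

lemma norm_level_le: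
  assumes "A \<in> Fc" "\<alpha> \<in> {0..1}" "v \<in> level A \<alpha>"
  shows "norm v \<le> Kc_norm (level A 0)"
  using assms level_antimono[of 0 \<alpha> A]
  by (intro norm_le_Kc_norm compact_level) auto

lemma support_fun_Lipschitz:
  assumes "A \<in> Fc" "\<alpha> \<in> {0..1}"
  shows "support_fun A (u, \<alpha>) \<le> support_fun A (w, \<alpha>) + Kc_norm (level A 0) * dist u w"
proof (rule support_fun_leI[OF assms])
  fix v assume v: "v \<in> level A \<alpha>"
  have "u \<bullet> v = w \<bullet> v + (u - w) \<bullet> v"
    by (simp add: inner_diff_left)
  also have "(u - w) \<bullet> v \<le> norm (u - w) * norm v"
    by (rule norm_cauchy_schwarz)
  also have "\<dots> \<le> dist u w * Kc_norm (level A 0)"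
    unfolding dist_norm by (intro mult_left_mono norm_level_le[OF assms v]) simp
  finally show "u \<bullet> v \<le> support_fun A (w, \<alpha>) + Kc_norm (level A 0) * dist u w"
    using inner_le_support_fun[OF assms v, of w] by (simp add: mult.commute)
qed

lemma abs_support_fun_le:
  assumes "A \<in> Fc" "\<alpha> \<in> {0..1}" "norm u = 1"
  shows "\<bar>support_fun A (u, \<alpha>)\<bar> \<le> Kc_norm (level A 0)"
proof -
  have *: "\<bar>u \<bullet> v\<bar> \<le> Kc_norm (level A 0)" if "v \<in> level A \<alpha>" for v
    using Cauchy_Schwarz_ineq2[of u v] norm_level_le[OF assms(1,2) that] assms(3) by simp
  obtain v where v: "v \<in> level A \<alpha>"
    using level_nonempty assms by blast
  have "support_fun A (u, \<alpha>) \<le> Kc_norm (level A 0)"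
    using * by (intro support_fun_leI assms) force
  moreover have "- Kc_norm (level A 0) \<le> support_fun A (u, \<alpha>)"
    using *[OF v] inner_le_support_fun[OF assms(1,2) v, of u] by linarith
  ultimately show ?thesis by linarith
qed

abbreviation support_measure :: "((real ^ 'p::finite) \<times> real) measure" where
  "support_measure \<equiv> sphere_haar \<Otimes>\<^sub>M unit_lebesgue"

lemma sets_sphere_haar: "sets sphere_haar = sets (restrict_space borel (sphere 0 1))"
  and prob_space_sphere_haar: "prob_space sphere_haar"
  using rotation_invariant_prob_sphere_haar by (auto simp: rotation_invariant_prob_def)

lemma prob_space_unit_lebesgue: "prob_space unit_lebesgue"
  by (rule prob_space_restrict_space) simp_all

lemma pair_prob_space_support_measure: "pair_prob_space sphere_haar unit_lebesgue"
  by (intro pair_prob_space.intro pair_sigma_finite.intro prob_space_sphere_haar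
      prob_space_unit_lebesgue prob_space_imp_sigma_finite)

lemma space_support_measure: "space support_measure = sphere 0 1 \<times> {0..1}"
  by (simp add: space_pair_measure space_restrict_space sets_eq_imp_space_eq[OF sets_sphere_haar])

text \<open>In \<open>u\<close> the support function is Lipschitz, with a constant that serves all levels; in \<open>\<alpha>\<close> it is
  decreasing, because the levels shrink, and hence Borel.\<close>

lemma borel_measurable_support_fun:
  assumes A: "A \<in> Fc"
  shows "support_fun A \<in> borel_measurable support_measure"
proof -
  have "(\<lambda>\<alpha>. support_fun A (u, \<alpha>)) \<in> borel_measurable unit_lebesgue" for u
  proof -
    have "mono_on {0..1} (\<lambda>\<alpha>. - support_fun A (u, \<alpha>))"
    proof (rule mono_onI)
      fix \<alpha> \<beta> :: real assume ab: "\<alpha> \<in> {0..1}" "\<beta> \<in> {0..1}" "\<alpha> \<le> \<beta>"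
      then have "support_fun A (u, \<beta>) \<le> support_fun A (u, \<alpha>)"
        using level_antimono[of \<alpha> \<beta> A]
        by (intro support_fun_leI[OF A] inner_le_support_fun[OF A]) auto
      then show "- support_fun A (u, \<alpha>) \<le> - support_fun A (u, \<beta>)" by simp
    qed
    from borel_measurable_mono_on_fnc[OF this]
    have "(\<lambda>\<alpha>. - support_fun A (u, \<alpha>)) \<in> borel_measurable unit_lebesgue"
      by (simp add: measurable_cong_sets[OF sets_restrict_space_cong[OF sets_lborel] refl])
    then show ?thesis
      by (simp add: borel_measurable_uminus_eq)
  qed
  then have borel: "support_fun A \<in> borel_measurable (borel \<Otimes>\<^sub>M unit_lebesgue)"
    by (intro measurable_pair_Lipschitz[where K = "Kc_norm (level A 0)"] support_fun_Lipschitz A)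
       (auto simp: space_restrict_space)
  have "(\<lambda>z. z) \<in> measurable support_measure (borel \<Otimes>\<^sub>M unit_lebesgue)"
  proof -
    have "(\<lambda>u. u) \<in> measurable sphere_haar borel"
      by (simp add: measurable_cong_sets[OF sets_sphere_haar refl] measurable_restrict_space1)
    then show ?thesis
      by (intro measurable_pair) (auto intro: measurable_compose[OF measurable_fst] simp: comp_def)
  qed
  from measurable_compose[OF this borel] show ?thesis
    by simp
qed

lemma (in prob_space) bounded_in_Lr_fun:
  assumes "f \<in> borel_measurable M" "\<And>x. x \<in> space M \<Longrightarrow> \<bar>f x\<bar> \<le> c" "0 \<le> r"
  shows "f \<in> Lr_fun r M"
  unfolding Lr_fun_def using assms
  by (auto intro!: integrable_const_bound[where B = "c powr r"] AE_I2 powr_mono2)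

lemma (in prob_space) Lr_norm_le_bound:
  assumes "f \<in> borel_measurable M" "\<And>x. x \<in> space M \<Longrightarrow> \<bar>f x\<bar> \<le> c" "1 \<le> r"
  shows "Lr_norm r M f \<le> c"
proof -
  have c: "0 \<le> c"
    using assms(2) not_empty by force
  have "(\<integral>x. \<bar>f x\<bar> powr r \<partial>M) \<le> (\<integral>x. c powr r \<partial>M)"
    using bounded_in_Lr_fun[OF assms(1,2)] assms
    by (intro integral_mono) (auto simp: Lr_fun_def intro!: powr_mono2)
  then have "Lr_norm r M f \<le> (c powr r) powr (1 / r)"
    unfolding Lr_norm_def using assms by (intro powr_mono2) (auto simp: prob_space)
  then show ?thesis
    using c assms by (simp add: powr_powr)
qed

lemma support_fun_in_Lr_fun:
  assumes "A \<in> Fc" "1 \<le> r"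
  shows "support_fun A \<in> Lr_fun r support_measure"
proof -
  interpret pair_prob_space sphere_haar unit_lebesgue
    by (rule pair_prob_space_support_measure)
  show ?thesis
    using assms
    by (intro P.bounded_in_Lr_fun[where c = "Kc_norm (level A 0)"] borel_measurable_support_fun)
       (auto simp: space_support_measure intro!: abs_support_fun_le)
qed

text \<open>Fubini turns the iterated integral that defines \<^const>\<open>rho\<close> into one over the product measure,
  the measure that functional symmetry refers to.\<close>

lemma rho_eq_Lr_norm:
  assumes "A \<in> Fc" "B \<in> Fc" "1 \<le> r"
  shows "rho r A B = Lr_norm r support_measure (\<lambda>z. support_fun A z - support_fun B z)"
proof -
  interpret pair_prob_space sphere_haar unit_lebesgue
    by (rule pair_prob_space_support_measure)
  have "(\<lambda>z. support_fun A z - support_fun B z) \<in> Lr_fun r support_measure"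
    using assms by (intro Lr_fun_diff support_fun_in_Lr_fun)
  then have "integrable support_measure
      (case_prod (\<lambda>u \<alpha>. \<bar>support_fun A (u, \<alpha>) - support_fun B (u, \<alpha>)\<bar> powr r))"
    by (simp add: Lr_fun_def case_prod_unfold)
  from integral_snd[OF this] show ?thesis
    by (simp add: rho_def Lr_norm_def case_prod_unfold)
qed

lemma rho_le:
  assumes "A \<in> Fc" "B \<in> Fc" "1 \<le> r"
  shows "rho r A B \<le> Kc_norm (level A 0) + Kc_norm (level B 0)"
proof -
  interpret pair_prob_space sphere_haar unit_lebesgue
    by (rule pair_prob_space_support_measure)
  have "\<bar>support_fun A z - support_fun B z\<bar> \<le> Kc_norm (level A 0) + Kc_norm (level B 0)"
    if "z \<in> space support_measure" for z
    using that assms abs_support_fun_le[of A "snd z" "fst z"] abs_support_fun_le[of B "snd z" "fst z"]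
    by (auto simp: space_support_measure)
  then show ?thesis
    unfolding rho_eq_Lr_norm[OF assms]
    using assms
    by (intro P.Lr_norm_le_bound borel_measurable_diff borel_measurable_support_fun)
qed


section \<open>Maximal depth at the centre of symmetry\<close>

text \<open>Without this the expected distance would be \<open>0\<close> by convention, and \<open>B\<close> would get the largest
  possible depth. Measurability in \<open>\<omega>\<close> comes from functional symmetry, which requires \<open>s\<^sub>X - s\<^sub>U\<close> to
  be a random element of \<open>L\<^sup>r\<close>; the dominating function is \<open>\<parallel>B\<^sub>0\<parallel> + \<parallel>X\<^sub>0\<parallel>\<close>.\<close>

lemma functionally_symmetric_integrable_rho:
  assumes "prob_space M" and r: "1 \<le> r" and X: "X \<in> L1_Fc M" and U: "U \<in> Fc" and B: "B \<in> Fc"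
    and sym: "functionally_symmetric r M X U"
  shows "integrable M (\<lambda>\<omega>. rho r B (X \<omega>))"
proof -
  interpret prob_space M by fact
  note in_Lr = support_fun_in_Lr_fun[OF _ r]
  have XF: "X \<omega> \<in> Fc" if "\<omega> \<in> space M" for \<omega>
    using X that by (auto simp: L1_Fc_def fuzzy_random_variable_def)
  have "(\<lambda>\<omega>. Lr_norm r support_measure (\<lambda>z. (support_fun (X \<omega>) z - support_fun U z)
      - (support_fun B z - support_fun U z))) \<in> borel_measurable M"
    using sym XF U B r
    by (intro measurable_Lr_norm_diff Lr_fun_diff in_Lr)
       (auto simp: functionally_symmetric_def identically_distributed_def Let_def)
  \<comment> \<open>The two occurrences of \<open>s\<^sub>U\<close> cancel.\<close>
  then have meas: "(\<lambda>\<omega>. rho r B (X \<omega>)) \<in> borel_measurable M"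
    by (rule measurable_cong[THEN iffD1, rotated])
       (simp add: rho_eq_Lr_norm XF B r Lr_norm_def abs_minus_commute)
  have int: "integrable M (\<lambda>\<omega>. Kc_norm (level B 0) + Kc_norm (level (X \<omega>) 0))"
    using X by (auto simp: L1_Fc_def)
  show ?thesis
  proof (rule Bochner_Integration.integrable_bound[OF int meas], rule AE_I2)
    fix \<omega> assume "\<omega> \<in> space M"
    from rho_le[OF B XF[OF this] r]
    show "norm (rho r B (X \<omega>)) \<le> norm (Kc_norm (level B 0) + Kc_norm (level (X \<omega>) 0))"
      by (simp add: rho_def)
  qed
qed

lemma functionally_symmetric_centre_minimal:
  assumes M: "prob_space M" and r: "1 \<le> r" and X: "X \<in> L1_Fc M" and U: "U \<in> Fc" and B: "B \<in> Fc"
    and sym: "functionally_symmetric r M X U"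
  shows "(\<integral>\<omega>. rho r U (X \<omega>) \<partial>M) \<le> (\<integral>\<omega>. rho r B (X \<omega>) \<partial>M)"
proof -
  note in_Lr = support_fun_in_Lr_fun[OF _ r]
  have XF: "X \<omega> \<in> Fc" if "\<omega> \<in> space M" for \<omega>
    using X that by (auto simp: L1_Fc_def fuzzy_random_variable_def)
  define y where "y = (\<lambda>\<omega> z. support_fun (X \<omega>) z - support_fun U z)"
  define h where "h z = support_fun B z - support_fun U z" for z
  have rhoU: "rho r U (X \<omega>) = Lr_norm r support_measure (y \<omega>)"
    and rhoB: "rho r B (X \<omega>) = Lr_norm r support_measure (\<lambda>z. y \<omega> z - h z)"
    if "\<omega> \<in> space M" for \<omega>
    using that by (simp_all add: rho_eq_Lr_norm XF U B r Lr_norm_def y_def h_def abs_minus_commute)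
  have "(\<integral>\<omega>. Lr_norm r support_measure (y \<omega>) \<partial>M)
      \<le> (\<integral>\<omega>. Lr_norm r support_measure (\<lambda>z. y \<omega> z - h z) \<partial>M)"
  proof (rule symmetric_random_element_centre_minimal[OF r])
    show "h \<in> Lr_fun r support_measure"
      unfolding h_def by (intro Lr_fun_diff in_Lr r B U)
    show "y \<omega> \<in> Lr_fun r support_measure" if "\<omega> \<in> space M" for \<omega>
      unfolding y_def by (intro Lr_fun_diff in_Lr r XF that U)
    show "identically_distributed M
        (metric_borel (Lr_space r support_measure) (Lr_dist r support_measure))
        (\<lambda>\<omega>. Lr_class r support_measure (y \<omega>)) (\<lambda>\<omega>. Lr_class r support_measure (\<lambda>z. - y \<omega> z))"
      using sym by (simp add: functionally_symmetric_def Let_def y_def)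
    show "integrable M (\<lambda>\<omega>. Lr_norm r support_measure (\<lambda>z. y \<omega> z - h z))"
      using functionally_symmetric_integrable_rho[OF assms]
      by (simp add: rhoB cong: Bochner_Integration.integrable_cong)
  qed
  then show ?thesis
    by (simp add: rhoU rhoB cong: Bochner_Integration.integral_cong)
qed

theorem theorem4p20:
  fixes r :: real and M :: "'w measure" and H :: "('w \<Rightarrow> 'p::finite fuzzy) set"
  assumes "prob_space M" and "1 \<le> r" and "H \<subseteq> L1_Fc M"
  shows "\<forall>X\<in>H. \<forall>U\<in>Fc. functionally_symmetric r M X U \<longrightarrow>
           natural_depth r M U X = (SUP B\<in>Fc. natural_depth r M B X)"
proof (intro ballI impI)
  fix X and U :: "'p fuzzy"
  assume X: "X \<in> H" and U: "U \<in> Fc" and sym: "functionally_symmetric r M X U"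
  have le: "natural_depth r M B X \<le> natural_depth r M U X" if B: "B \<in> Fc" for B
  proof -
    have "0 \<le> (\<integral>\<omega>. rho r U (X \<omega>) \<partial>M)"
      by (intro integral_nonneg_AE AE_I2) (simp add: rho_def)
    then show ?thesis
      unfolding natural_depth_def
      using functionally_symmetric_centre_minimal[OF assms(1,2) _ U B sym] assms(3) X
      by (intro le_imp_inverse_le) auto
  qed
  show "natural_depth r M U X = (SUP B\<in>Fc. natural_depth r M B X)"
    using U le by (intro cSup_eq_maximum[symmetric]) auto
qed

end
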